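(* Let $X$ be a topological space. Then the following six properties of $X$ are equivalent: $X$ is $e^*\theta$-$T_0$; $X$ is $e^*\theta$-$T_1$; $X$ is $e^*\theta$-$T_2$; $X$ is $e^*$-$\theta$-$D_0$; $X$ is $e^*$-$\theta$-$D_1$; $X$ is $e^*$-$\theta$-$D_2$.
   Context: No separation axioms are assumed on topological spaces. For a subset $A$ of a topological space $X$, $cl(A)$ and $int(A)$ denote closure and interior, and $\delta\text{-}cl(A)=\{x\in X : int(cl(U))\cap A\neq\emptyset \text{ for every open } U \ni x\}$. $A$ is $e^*$-open if $A\subseteq cl(int(\delta\text{-}cl(A)))$; $e^*$-closed if its complement is $e^*$-open. $e^*\text{-}cl(A)$ is the intersection of all $e^*$-closed sets containing $A$. The $e^*$-$\theta$-closure of $A$ is $e^*\text{-}cl_\theta(A)=\{x\in X : e^*\text{-}cl(U)\cap A\neq\emptyset \text{ for every } e^*\text{-open } U\ni x\}$. $A$ is $e^*$-$\theta$-closed if $A=e^*\text{-}cl_\theta(A)$; $e^*$-$\theta$-open if its complement is $e^*$-$\theta$-closed. A subset $A$ of $X$ is an $e^*$-$\theta$-$D$-set if there exist $e^*$-$\theta$-open sets $U,V$ with $U\neq X$ and $A=U\setminus V$. $X$ is $e^*$-$\theta$-$D_0$ if for any distinct points $x,y\in X$ there is an $e^*$-$\theta$-$D$-set containing $x$ but not $y$ or an $e^*$-$\theta$-$D$-set containing $y$ but not $x$. $X$ is $e^*$-$\theta$-$D_1$ if for any distinct $x,y\in X$ there is an $e^*$-$\theta$-$D$-set containing $x$ but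 not $y$ and an $e^*$-$\theta$-$D$-set containing $y$ but not $x$. $X$ is $e^*$-$\theta$-$D_2$ if for any distinct $x,y\in X$ there are disjoint $e^*$-$\theta$-$D$-sets $U\ni x$ and $V\ni y$. $X$ is $e^*\theta$-$T_0$ if for any distinct $x,y\in X$ there is an $e^*$-$\theta$-open set containing $x$ but not $y$ or an $e^*$-$\theta$-open set containing $y$ but not $x$. $X$ is $e^*\theta$-$T_1$ if for any distinct $x,y\in X$ there is an $e^*$-$\theta$-open set containing $x$ but not $y$ and an $e^*$-$\theta$-open set containing $y$ but not $x$. $X$ is $e^*\theta$-$T_2$ if for any distinct $x,y\in X$ there are disjoint $e^*$-$\theta$-open sets $U\ni x$ and $V\ni y$. *)

theory Defs
  imports "HOL-Analysis.Abstract_Topology"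
begin

definition delta_closure_of :: "'a topology \<Rightarrow> 'a set \<Rightarrow> 'a set" where
  "delta_closure_of X A =
     {x \<in> topspace X. \<forall>U. openin X U \<and> x \<in> U \<longrightarrow> X interior_of (X closure_of U) \<inter> A \<noteq> {}}"

(* The condition forces A \<subseteq> topspace X, since every closure lies in the carrier. *)
definition estar_openin :: "'a topology \<Rightarrow> 'a set \<Rightarrow> bool" where
  "estar_openin X A \<longleftrightarrow> A \<subseteq> X closure_of (X interior_of (delta_closure_of X A))"

definition estar_closedin :: "'a topology \<Rightarrow> 'a set \<Rightarrow> bool" where
  "estar_closedin X A \<longleftrightarrow> A \<subseteq> topspace X \<and> estar_openin X (topspace X - A)"

(* Meaningful only for A \<subseteq> topspace X; then topspace X belongs to the intersected family. *)
definition estar_closure_of :: "'a topology \<Rightarrow> 'a set \<Rightarrow> 'a set" where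
  "estar_closure_of X A = \<Inter>{F. estar_closedin X F \<and> A \<subseteq> F}"

definition estar_theta_closure_of :: "'a topology \<Rightarrow> 'a set \<Rightarrow> 'a set" where
  "estar_theta_closure_of X A =
     {x \<in> topspace X. \<forall>U. estar_openin X U \<and> x \<in> U \<longrightarrow> estar_closure_of X U \<inter> A \<noteq> {}}"

definition estar_theta_closedin :: "'a topology \<Rightarrow> 'a set \<Rightarrow> bool" where
  "estar_theta_closedin X A \<longleftrightarrow> A = estar_theta_closure_of X A"

definition estar_theta_openin :: "'a topology \<Rightarrow> 'a set \<Rightarrow> bool" where
  "estar_theta_openin X A \<longleftrightarrow> A \<subseteq> topspace X \<and> estar_theta_closedin X (topspace X - A)"

definition estar_theta_D_set :: "'a topology \<Rightarrow> 'a set \<Rightarrow> bool" where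
  "estar_theta_D_set X A \<longleftrightarrow>
     (\<exists>U V. estar_theta_openin X U \<and> estar_theta_openin X V \<and> U \<noteq> topspace X \<and> A = U - V)"

definition estar_theta_D0_space :: "'a topology \<Rightarrow> bool" where
  "estar_theta_D0_space X \<longleftrightarrow>
     (\<forall>x \<in> topspace X. \<forall>y \<in> topspace X. x \<noteq> y \<longrightarrow>
        (\<exists>A. estar_theta_D_set X A \<and> x \<in> A \<and> y \<notin> A) \<or>
        (\<exists>A. estar_theta_D_set X A \<and> y \<in> A \<and> x \<notin> A))"

definition estar_theta_D1_space :: "'a topology \<Rightarrow> bool" where
  "estar_theta_D1_space X \<longleftrightarrow>
     (\<forall>x \<in> topspace X. \<forall>y \<in> topspace X. x \<noteq> y \<longrightarrow>
        (\<exists>A. estar_theta_D_set X A \<and> x \<in> A \<and> y \<notin> A) \<and>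
        (\<exists>A. estar_theta_D_set X A \<and> y \<in> A \<and> x \<notin> A))"

definition estar_theta_D2_space :: "'a topology \<Rightarrow> bool" where
  "estar_theta_D2_space X \<longleftrightarrow>
     (\<forall>x \<in> topspace X. \<forall>y \<in> topspace X. x \<noteq> y \<longrightarrow>
        (\<exists>U V. estar_theta_D_set X U \<and> estar_theta_D_set X V \<and> x \<in> U \<and> y \<in> V \<and> disjnt U V))"

definition estar_theta_T0_space :: "'a topology \<Rightarrow> bool" where
  "estar_theta_T0_space X \<longleftrightarrow>
     (\<forall>x \<in> topspace X. \<forall>y \<in> topspace X. x \<noteq> y \<longrightarrow>
        (\<exists>U. estar_theta_openin X U \<and> x \<in> U \<and> y \<notin> U) \<or>
        (\<exists>U. estar_theta_openin X U \<and> y \<in> U \<and> x \<notin> U))"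

definition estar_theta_T1_space :: "'a topology \<Rightarrow> bool" where
  "estar_theta_T1_space X \<longleftrightarrow>
     (\<forall>x \<in> topspace X. \<forall>y \<in> topspace X. x \<noteq> y \<longrightarrow>
        (\<exists>U. estar_theta_openin X U \<and> x \<in> U \<and> y \<notin> U) \<and>
        (\<exists>U. estar_theta_openin X U \<and> y \<in> U \<and> x \<notin> U))"

definition estar_theta_T2_space :: "'a topology \<Rightarrow> bool" where
  "estar_theta_T2_space X \<longleftrightarrow>
     (\<forall>x \<in> topspace X. \<forall>y \<in> topspace X. x \<noteq> y \<longrightarrow>
        (\<exists>U V. estar_theta_openin X U \<and> estar_theta_openin X V \<and> x \<in> U \<and> y \<in> V \<and> disjnt U V))"

end

theory Submission
  imports Defs
begin

text \<open>
  The collapse of the separation axioms comes from one property of the operator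
  \<open>estar_closure_of\<close>: it sends \<open>e*\<close>-open sets to \<open>e*\<close>-open sets
  (\<open>estar_openin_closure_of\<close>), so the closures that define the \<open>\<theta>\<close>-closure are
  \<open>e*\<close>-clopen. Hence an \<open>e*\<close>-\<open>\<theta>\<close>-open set contains, around each of its points \<open>x\<close>, an
  \<open>e*\<close>-clopen set \<open>R\<close> (\<open>estar_theta_openin_contains_clopen\<close>). Both \<open>R\<close> and its
  complement are \<open>e*\<close>-\<open>\<theta>\<close>-open (\<open>estar_clopen_imp_theta_openin\<close>), so a single
  \<open>e*\<close>-\<open>\<theta>\<close>-open set that contains \<open>x\<close> and misses \<open>y\<close> already yields disjoint
  \<open>e*\<close>-\<open>\<theta>\<close>-open neighbourhoods of the two points: \<open>T\<^sub>0\<close> implies \<open>T\<^sub>2\<close>.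

  The \<open>D\<close>-axioms lie in between. A proper \<open>e*\<close>-\<open>\<theta>\<close>-open set is a \<open>D\<close>-set, which gives
  \<open>D\<^sub>2\<close> from \<open>T\<^sub>2\<close>; and if \<open>U - V\<close> separates \<open>x\<close> from \<open>y\<close>, then \<open>U\<close> or \<open>V\<close> separates
  them, which gives \<open>T\<^sub>0\<close> from \<open>D\<^sub>0\<close>.
\<close>

section \<open>The e*-closure of an e*-open set\<close>

lemma delta_closure_of_mono:
  "A \<subseteq> B \<Longrightarrow> delta_closure_of X A \<subseteq> delta_closure_of X B"
  unfolding delta_closure_of_def by blast

lemma estar_openin_subset_topspace: "estar_openin X A \<Longrightarrow> A \<subseteq> topspace X"
  unfolding estar_openin_def using closure_of_subset_topspace by fast

lemma estar_openin_superset_bound: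
  assumes "estar_openin X A" "A \<subseteq> B"
  shows "A \<subseteq> X closure_of (X interior_of (delta_closure_of X B))"
proof -
  have "X closure_of (X interior_of (delta_closure_of X A))
        \<subseteq> X closure_of (X interior_of (delta_closure_of X B))"
    by (intro closure_of_mono interior_of_mono delta_closure_of_mono assms(2))
  then show ?thesis
    using assms(1) unfolding estar_openin_def by blast
qed

lemma estar_openin_Union:
  assumes "\<And>A. A \<in> \<A> \<Longrightarrow> estar_openin X A"
  shows "estar_openin X (\<Union>\<A>)"
  unfolding estar_openin_def
  using estar_openin_superset_bound[OF assms Union_upper] by blast

lemma openin_imp_estar_openin:
  assumes "openin X W"
  shows "estar_openin X W"
proof -
  have "W \<subseteq> delta_closure_of X W"
  proof
    fix x assume x: "x \<in> W"
    have "x \<in> X interior_of (X closure_of U)" if "openin X U" "x \<in> U" for U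
      using that interior_of_maximal[OF closure_of_subset[OF openin_subset]] by blast
    then show "x \<in> delta_closure_of X W"
      unfolding delta_closure_of_def using x openin_subset[OF assms] by blast
  qed
  then have int: "W \<subseteq> X interior_of (delta_closure_of X W)"
    using assms by (rule interior_of_maximal)
  also have "\<dots> \<subseteq> X closure_of (X interior_of (delta_closure_of X W))"
    by (rule closure_of_subset) (rule interior_of_subset_topspace)
  finally show ?thesis unfolding estar_openin_def .
qed

lemma closedin_imp_estar_closedin: "closedin X C \<Longrightarrow> estar_closedin X C"
  unfolding estar_closedin_def closedin_def by (simp add: openin_imp_estar_openin)

lemma estar_openin_empty: "estar_openin X {}"
  by (simp add: estar_openin_def)

lemma estar_closedin_topspace: "estar_closedin X (topspace X)"
  by (simp add: estar_closedin_def estar_openin_empty)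

lemma estar_closedin_Inter:
  assumes "\<F> \<noteq> {}" "\<And>F. F \<in> \<F> \<Longrightarrow> estar_closedin X F"
  shows "estar_closedin X (\<Inter>\<F>)"
proof -
  have "topspace X - \<Inter>\<F> = \<Union>((\<lambda>F. topspace X - F) ` \<F>)" by blast
  moreover have "estar_openin X (\<Union>((\<lambda>F. topspace X - F) ` \<F>))"
    using assms(2) by (intro estar_openin_Union) (auto simp: estar_closedin_def)
  moreover have "\<Inter>\<F> \<subseteq> topspace X"
    using assms unfolding estar_closedin_def by blast
  ultimately show ?thesis by (simp add: estar_closedin_def)
qed

lemma estar_closure_of_subset: "A \<subseteq> estar_closure_of X A"
  unfolding estar_closure_of_def by blast

lemma estar_closure_of_minimal:
  "estar_closedin X F \<Longrightarrow> A \<subseteq> F \<Longrightarrow> estar_closure_of X A \<subseteq> F"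
  unfolding estar_closure_of_def by blast

lemma estar_closedin_closure_of:
  assumes "A \<subseteq> topspace X"
  shows "estar_closedin X (estar_closure_of X A)"
  unfolding estar_closure_of_def
  by (rule estar_closedin_Inter) (use assms estar_closedin_topspace in auto)

text \<open>
  The set \<open>cl (int (\<delta>-cl U))\<close> that bounds an \<open>e*\<close>-open \<open>U\<close> is closed, hence \<open>e*\<close>-closed, so it
  bounds the \<open>e*\<close>-closure of \<open>U\<close> as well; enlarging \<open>U\<close> to its \<open>e*\<close>-closure inside the bound
  only makes the bound larger.
\<close>

lemma estar_openin_closure_of:
  assumes "estar_openin X U"
  shows "estar_openin X (estar_closure_of X U)"
  unfolding estar_openin_def
  by (intro estar_closure_of_minimal closedin_imp_estar_closedin closedin_closure_of
      estar_openin_superset_bound assms estar_closure_of_subset)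

section \<open>e*-clopen sets and the theta-topology\<close>

lemma subset_estar_theta_closure_of:
  assumes "A \<subseteq> topspace X"
  shows "A \<subseteq> estar_theta_closure_of X A"
  unfolding estar_theta_closure_of_def using assms estar_closure_of_subset by fast

text \<open>
  A point outside an \<open>e*\<close>-clopen set \<open>R\<close> is kept away from the \<open>\<theta>\<close>-closure of \<open>R\<close> by the
  complement of \<open>R\<close>, which is \<open>e*\<close>-open and equals its own \<open>e*\<close>-closure.
\<close>

lemma estar_clopen_imp_theta_closedin:
  assumes "estar_openin X R" "estar_closedin X R"
  shows "estar_theta_closedin X R"
proof -
  have R: "R \<subseteq> topspace X" and open_compl: "estar_openin X (topspace X - R)"
    using assms(2) by (auto simp: estar_closedin_def)
  have "topspace X - (topspace X - R) = R" using R by blast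
  then have "estar_closedin X (topspace X - R)"
    using assms(1) by (simp add: estar_closedin_def)
  then have "estar_closure_of X (topspace X - R) \<inter> R = {}"
    using estar_closure_of_minimal[OF _ subset_refl] by blast
  then have "estar_theta_closure_of X R \<subseteq> R"
    unfolding estar_theta_closure_of_def using open_compl by blast
  then show ?thesis
    unfolding estar_theta_closedin_def using subset_estar_theta_closure_of[OF R] by blast
qed

lemma estar_clopen_compl:
  assumes "estar_openin X R" "estar_closedin X R"
  shows "estar_openin X (topspace X - R)" "estar_closedin X (topspace X - R)"
  using assms by (auto simp: estar_closedin_def double_diff)

lemma estar_clopen_imp_theta_openin:
  assumes "estar_openin X R" "estar_closedin X R"
  shows "estar_theta_openin X R"
  using estar_clopen_imp_theta_closedin[OF estar_clopen_compl[OF assms]] assms(2)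
  by (simp add: estar_theta_openin_def estar_closedin_def)

lemma estar_theta_openin_contains_clopen:
  assumes "estar_theta_openin X U" "x \<in> U"
  obtains R where "estar_openin X R" "estar_closedin X R" "x \<in> R" "R \<subseteq> U"
proof -
  have U: "U \<subseteq> topspace X"
    and fix_compl: "estar_theta_closure_of X (topspace X - U) = topspace X - U"
    using assms(1) by (auto simp: estar_theta_openin_def estar_theta_closedin_def)
  have "x \<notin> estar_theta_closure_of X (topspace X - U)"
    using fix_compl assms(2) by simp
  then obtain W where W: "estar_openin X W" "x \<in> W"
      and disj: "estar_closure_of X W \<inter> (topspace X - U) = {}"
    using assms(2) U unfolding estar_theta_closure_of_def by blast
  have closed: "estar_closedin X (estar_closure_of X W)"
    by (rule estar_closedin_closure_of[OF estar_openin_subset_topspace[OF W(1)]])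
  show thesis
  proof
    show "estar_openin X (estar_closure_of X W)" by (rule estar_openin_closure_of[OF W(1)])
    show "estar_closedin X (estar_closure_of X W)" by (rule closed)
    show "x \<in> estar_closure_of X W" using W(2) estar_closure_of_subset by fast
    show "estar_closure_of X W \<subseteq> U" using disj closed by (auto simp: estar_closedin_def)
  qed
qed

lemma estar_theta_openin_separates:
  assumes "estar_theta_openin X U" "x \<in> U" "y \<in> topspace X" "y \<notin> U"
  obtains V W where "estar_theta_openin X V" "estar_theta_openin X W" "x \<in> V" "y \<in> W" "disjnt V W"
proof -
  obtain R where R: "estar_openin X R" "estar_closedin X R" "x \<in> R" "R \<subseteq> U"
    using estar_theta_openin_contains_clopen[OF assms(1,2)] .
  show thesis
  proof
    show "estar_theta_openin X R"
      by (rule estar_clopen_imp_theta_openin[OF R(1,2)])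
    show "estar_theta_openin X (topspace X - R)"
      by (rule estar_clopen_imp_theta_openin[OF estar_clopen_compl[OF R(1,2)]])
    show "x \<in> R" "y \<in> topspace X - R" "disjnt R (topspace X - R)"
      using R assms(3,4) by (auto simp: disjnt_def)
  qed
qed

section \<open>Separation axioms\<close>

lemma estar_theta_T0_imp_T2:
  assumes "estar_theta_T0_space X"
  shows "estar_theta_T2_space X"
  unfolding estar_theta_T2_space_def
proof (intro ballI impI)
  fix x y assume xy: "x \<in> topspace X" "y \<in> topspace X" "x \<noteq> y"
  then consider U where "estar_theta_openin X U" "x \<in> U" "y \<notin> U"
    | U where "estar_theta_openin X U" "y \<in> U" "x \<notin> U"
    using assms unfolding estar_theta_T0_space_def by blast
  then show "\<exists>U V. estar_theta_openin X U \<and> estar_theta_openin X V \<and> x \<in> U \<and> y \<in> V \<and> disjnt U V"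
  proof cases
    case 1
    show ?thesis by (rule estar_theta_openin_separates[OF 1(1,2) xy(2) 1(3)]) blast
  next
    case 2
    show ?thesis
      by (rule estar_theta_openin_separates[OF 2(1,2) xy(1) 2(3)]) (blast dest: disjnt_sym)
  qed
qed

lemma estar_theta_T2_imp_T1:
  assumes "estar_theta_T2_space X"
  shows "estar_theta_T1_space X"
  unfolding estar_theta_T1_space_def
proof (intro ballI impI)
  fix x y assume "x \<in> topspace X" "y \<in> topspace X" "x \<noteq> y"
  then obtain U V where UV: "estar_theta_openin X U" "estar_theta_openin X V"
      "x \<in> U" "y \<in> V" "disjnt U V"
    using assms unfolding estar_theta_T2_space_def by blast
  then have "x \<notin> V" "y \<notin> U" by (auto simp: disjnt_iff)
  then show "(\<exists>U. estar_theta_openin X U \<and> x \<in> U \<and> y \<notin> U) \<and>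
        (\<exists>U. estar_theta_openin X U \<and> y \<in> U \<and> x \<notin> U)"
    using UV by blast
qed

lemma estar_theta_T1_imp_T0: "estar_theta_T1_space X \<Longrightarrow> estar_theta_T0_space X"
  unfolding estar_theta_T1_space_def estar_theta_T0_space_def by blast

lemma estar_theta_D2_imp_D1:
  assumes "estar_theta_D2_space X"
  shows "estar_theta_D1_space X"
  unfolding estar_theta_D1_space_def
proof (intro ballI impI)
  fix x y assume "x \<in> topspace X" "y \<in> topspace X" "x \<noteq> y"
  then obtain U V where UV: "estar_theta_D_set X U" "estar_theta_D_set X V"
      "x \<in> U" "y \<in> V" "disjnt U V"
    using assms unfolding estar_theta_D2_space_def by blast
  then have "x \<notin> V" "y \<notin> U" by (auto simp: disjnt_iff)
  then show "(\<exists>U. estar_theta_D_set X U \<and> x \<in> U \<and> y \<notin> U) \<and>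
        (\<exists>U. estar_theta_D_set X U \<and> y \<in> U \<and> x \<notin> U)"
    using UV by blast
qed

lemma estar_theta_D1_imp_D0: "estar_theta_D1_space X \<Longrightarrow> estar_theta_D0_space X"
  unfolding estar_theta_D1_space_def estar_theta_D0_space_def by blast

lemma estar_theta_openin_imp_D_set:
  assumes "estar_theta_openin X U" "U \<noteq> topspace X"
  shows "estar_theta_D_set X U"
proof -
  have "estar_theta_openin X {}"
    by (rule estar_clopen_imp_theta_openin)
      (simp_all add: estar_openin_empty closedin_imp_estar_closedin)
  then show ?thesis
    unfolding estar_theta_D_set_def using assms by blast
qed

text \<open>Of two disjoint sets that each contain a point, neither is the whole space.\<close>

lemma estar_theta_T2_imp_D2:
  assumes "estar_theta_T2_space X"
  shows "estar_theta_D2_space X"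
  unfolding estar_theta_D2_space_def
proof (intro ballI impI)
  fix x y assume xy: "x \<in> topspace X" "y \<in> topspace X" "x \<noteq> y"
  then obtain U V where UV: "estar_theta_openin X U" "estar_theta_openin X V"
      "x \<in> U" "y \<in> V" "disjnt U V"
    using assms unfolding estar_theta_T2_space_def by blast
  then have "U \<noteq> topspace X" "V \<noteq> topspace X"
    using xy by (auto simp: disjnt_iff)
  then show "\<exists>U V. estar_theta_D_set X U \<and> estar_theta_D_set X V \<and> x \<in> U \<and> y \<in> V \<and> disjnt U V"
    using UV estar_theta_openin_imp_D_set by blast
qed

text \<open>If \<open>x \<in> U - V\<close> and \<open>y \<notin> U - V\<close>, then \<open>U\<close> misses \<open>y\<close>, or else \<open>V\<close> contains \<open>y\<close> and misses
  \<open>x\<close>. Which of the two points the open set contains cannot be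
  prescribed, as in the definition of \<open>T\<^sub>0\<close>.\<close>

lemma estar_theta_D0_imp_T0:
  assumes "estar_theta_D0_space X"
  shows "estar_theta_T0_space X"
proof -
  have separated: "(\<exists>U. estar_theta_openin X U \<and> x \<in> U \<and> y \<notin> U) \<or>
        (\<exists>U. estar_theta_openin X U \<and> y \<in> U \<and> x \<notin> U)"
    if "estar_theta_D_set X A" "x \<in> A" "y \<notin> A" for A x y
    using that unfolding estar_theta_D_set_def by blast
  show ?thesis
    unfolding estar_theta_T0_space_def
  proof (intro ballI impI)
    fix x y assume "x \<in> topspace X" "y \<in> topspace X" "x \<noteq> y"
    then consider A where "estar_theta_D_set X A" "x \<in> A" "y \<notin> A"
      | A where "estar_theta_D_set X A" "y \<in> A" "x \<notin> A"
      using assms unfolding estar_theta_D0_space_def by blast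
    then show "(\<exists>U. estar_theta_openin X U \<and> x \<in> U \<and> y \<notin> U) \<or>
        (\<exists>U. estar_theta_openin X U \<and> y \<in> U \<and> x \<notin> U)"
    proof cases
      case 1
      then show ?thesis by (rule separated)
    next
      case 2
      then show ?thesis using separated[OF 2] by argo
    qed
  qed
qed

theorem corollary4p13:
  fixes X :: "'a topology"
  shows "(estar_theta_T0_space X \<longleftrightarrow> estar_theta_T1_space X) \<and>
         (estar_theta_T1_space X \<longleftrightarrow> estar_theta_T2_space X) \<and>
         (estar_theta_T2_space X \<longleftrightarrow> estar_theta_D0_space X) \<and>
         (estar_theta_D0_space X \<longleftrightarrow> estar_theta_D1_space X) \<and>
         (estar_theta_D1_space X \<longleftrightarrow> estar_theta_D2_space X)"
  using estar_theta_T0_imp_T2 estar_theta_T2_imp_T1 estar_theta_T1_imp_T0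
    estar_theta_T2_imp_D2 estar_theta_D2_imp_D1 estar_theta_D1_imp_D0 estar_theta_D0_imp_T0
  by blast

end
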